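(* For each integer $k \ge 1$, there exists a connected graph $G$ such that $\mathrm{cdim}(G)-\dim(G)=k$.
   Context: All graphs are finite, simple, undirected, of order at least two. A set $S\subseteq V(G)$ is a resolving set of $G$ if for every pair of distinct vertices $x,y$ of $G$ there is $z\in S$ with $d(x,z)\ne d(y,z)$ ($d$ is the shortest-path distance); it is a connected resolving set if moreover the induced subgraph $G[S]$ is connected. $\dim(G)$ is the minimum cardinality of a resolving set of $G$, and $\mathrm{cdim}(G)$ is the minimum cardinality of a connected resolving set of $G$. *)

theory Defs
  imports "Graph_Theory.Graph_Theory"
begin

text \<open>
  Undirected graphs are symmetric digraphs, as in \<^locale>\<open>pair_graph\<close>: finite, loop-free, and without
  parallel arcs, since arcs are pairs of vertices.
\<close>

text \<open>The shortest-path distance is the library's minimal walk cost for unit arc weights.\<close>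

definition gdist :: "('a, 'b) pre_digraph \<Rightarrow> 'a \<Rightarrow> 'a \<Rightarrow> ereal" where
  "gdist G u v = wf_digraph.\<mu> G (\<lambda>_. 1) u v"

definition resolving_set :: "('a, 'b) pre_digraph \<Rightarrow> 'a set \<Rightarrow> bool" where
  "resolving_set G S \<longleftrightarrow>
     S \<subseteq> verts G \<and>
     (\<forall>x \<in> verts G. \<forall>y \<in> verts G. x \<noteq> y \<longrightarrow> (\<exists>z \<in> S. gdist G x z \<noteq> gdist G y z))"

definition connected_resolving_set :: "('a, 'b) pre_digraph \<Rightarrow> 'a set \<Rightarrow> bool" where
  "connected_resolving_set G S \<longleftrightarrow>
     resolving_set G S \<and> Digraph_Component.connected (G \<restriction> S)"

text \<open>
  In a graph the whole vertex set is resolving, and it is a connected resolving set if the graph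
  is connected, so both minima below are attained there.
\<close>

definition metric_dim :: "('a, 'b) pre_digraph \<Rightarrow> nat" where
  "metric_dim G = (LEAST n. \<exists>S. resolving_set G S \<and> card S = n)"

definition connected_metric_dim :: "('a, 'b) pre_digraph \<Rightarrow> nat" where
  "connected_metric_dim G = (LEAST n. \<exists>S. connected_resolving_set G S \<and> card S = n)"

end

theory Submission
  imports Defs
begin

text \<open>
  Take a path with \<open>k + 2\<close> vertices and replace each of its two end vertices by a pair of adjacent
  twins. No vertex outside a pair of twins tells the two apart, so every resolving set contains a
  vertex of each pair (\<open>resolving_set_meets_twins\<close>). Conversely one vertex from each pair
  suffices: the two distances together locate a vertex on the path and separate the twins
  (\<open>resolving_set_if_ends\<close>). Hence the metric dimension is 2.

  A connected resolving set must in addition contain, by a discrete intermediate value argument,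
  a vertex at every position of the path between its two ends
  (\<open>connected_covers_levels\<close>), that is \<open>k + 2\<close> vertices; a shortest path from one
  pair to the other attains this bound. The difference is therefore \<open>k\<close>.
\<close>

section \<open>Distances and connectedness\<close>

text \<open>
  A potential with value zero at the target that drops by at most one along each arc, and by
  exactly one along some arc out of every other vertex, is the distance to the target: the first
  property bounds the length of every walk from below, and following the arcs of descent gives a
  walk that attains the bound.
\<close>

lemma gdist_eq_potential:
  fixes f :: "'a \<Rightarrow> nat"
  assumes wf: "wf_digraph G"
    and zero: "f v = 0"
    and lipschitz: "\<And>e. e \<in> arcs G \<Longrightarrow> f (tail G e) \<le> Suc (f (head G e))"
    and descent: "\<And>w. w \<in> verts G \<Longrightarrow> w \<noteq> v \<Longrightarrow>
      \<exists>e \<in> arcs G. tail G e = w \<and> f w = Suc (f (head G e))"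
    and u: "u \<in> verts G"
  shows "gdist G u v = ereal (real (f u))"
proof -
  interpret wf_digraph G by (fact wf)
  have cost: "awalk_cost (\<lambda>_. 1) p = real (length p)" for p
    by (induction p) auto
  have lower: "f w \<le> length p" if "awalk w p v" for w p
    using that
  proof (induction p arbitrary: w)
    case Nil
    then show ?case using zero by (simp add: awalk_Nil_iff)
  next
    case (Cons e p)
    then show ?case using lipschitz[of e] by (fastforce simp: awalk_Cons_iff)
  qed
  have upper: "\<exists>p. awalk w p v \<and> length p = f w" if "w \<in> verts G" for w
    using that
  proof (induction "f w" arbitrary: w)
    case 0
    then have "w = v" using descent[of w] by auto
    then show ?case using 0 by (intro exI[of _ "[]"]) (simp add: awalk_Nil_iff)
  next
    case (Suc m)
    then have "w \<noteq> v" using zero by auto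
    then obtain e where e: "e \<in> arcs G" "tail G e = w" "f w = Suc (f (head G e))"
      using descent Suc.prems by blast
    then obtain p where "awalk (head G e) p v" "length p = f (head G e)"
      using Suc.hyps by fastforce
    then show ?case using e by (intro exI[of _ "e # p"]) (simp add: awalk_Cons_iff)
  qed
  obtain p where p: "awalk u p v" "length p = f u"
    using upper[OF u] by blast
  show ?thesis
    unfolding gdist_def \<mu>_def
  proof (rule antisym)
    show "(INF q\<in>{q. awalk u q v}. ereal (awalk_cost (\<lambda>_. 1) q)) \<le> ereal (real (f u))"
      using p by (intro INF_lower2[of p]) (auto simp: cost)
    show "ereal (real (f u)) \<le> (INF q\<in>{q. awalk u q v}. ereal (awalk_cost (\<lambda>_. 1) q))"
      using lower by (intro INF_greatest) (auto simp: cost)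
  qed
qed

lemma connected_if_successive_adjacent:
  fixes H :: "(nat, 'b) pre_digraph"
  assumes verts: "verts H = {a..b}" and "a \<le> b"
    and succ: "\<And>i. a \<le> i \<Longrightarrow> i < b \<Longrightarrow> (i, Suc i) \<in> arcs_ends H"
  shows "Digraph_Component.connected H"
proof -
  let ?R = "rtrancl_on {a..b} ((arcs_ends H)\<^sup>s)"
  have both: "(a, x) \<in> ?R \<and> (x, a) \<in> ?R" if "a \<le> x" "x \<le> b" for x
    using that
  proof (induction x rule: dec_induct)
    case base
    then show ?case by auto
  next
    case (step i)
    then have "(i, Suc i) \<in> (arcs_ends H)\<^sup>s" "(Suc i, i) \<in> (arcs_ends H)\<^sup>s"
      using succ[of i] by (auto simp: symcl_def intro: rev_image_eqI)
    then show ?case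
      using step by (auto intro: rtrancl_on_into_rtrancl_on converse_rtrancl_on_into_rtrancl_on)
  qed
  have "(x, y) \<in> ?R" if "x \<in> {a..b}" "y \<in> {a..b}" for x y
    using rtrancl_on_trans both[of x] both[of y] that by (metis atLeastAtMost_iff)
  then show ?thesis
    unfolding connected_conv verts using \<open>a \<le> b\<close> by auto
qed

text \<open>
  The discrete intermediate value theorem. It is what makes connectedness expensive: a connected
  set with a vertex at each end of the path cannot skip a position in between.
\<close>

lemma connected_label_ivt:
  fixes l :: "'a \<Rightarrow> nat"
  assumes conn: "Digraph_Component.connected H"
    and lipschitz: "\<And>x y. (x, y) \<in> arcs_ends H \<Longrightarrow> l x \<le> Suc (l y) \<and> l y \<le> Suc (l x)"
    and a: "a \<in> verts H" and b: "b \<in> verts H"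
  shows "{l a..l b} \<subseteq> l ` verts H"
proof -
  have "(a, b) \<in> rtrancl_on (verts H) ((arcs_ends H)\<^sup>s)"
    using conn a b by (auto simp: connected_conv)
  then show ?thesis
  proof (induction rule: rtrancl_on_induct)
    case base
    then show ?case by auto
  next
    case (step y z)
    then have "l z \<le> Suc (l y)" using lipschitz by (auto simp: symcl_def)
    then have "{l a..l z} \<subseteq> {l a..l y} \<union> {l z}" by auto
    then show ?case using step by blast
  qed
qed

section \<open>The path with doubled ends\<close>

text \<open>
  The level is the position on the path with vertices \<open>0, \<dots>, n\<close> from which the graph is
  obtained by doubling the ends. The truncated difference puts both \<open>0\<close> and \<open>1\<close> at
  level \<open>0\<close>, the minimum puts both \<open>n + 1\<close> and \<open>n + 2\<close> at level
  \<open>n\<close>, and for \<open>j \<le> n\<close> the vertex \<open>j + 1\<close> has level \<open>j\<close>.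
\<close>

definition level :: "nat \<Rightarrow> nat \<Rightarrow> nat" where
  "level n x = min (x - 1) n"

definition doubled_path :: "nat \<Rightarrow> nat pair_pre_digraph" where
  "doubled_path n = \<lparr> pverts = {0..n + 2},
     parcs = {(x, y). x \<in> {0..n + 2} \<and> y \<in> {0..n + 2} \<and> x \<noteq> y \<and>
       level n x \<le> Suc (level n y) \<and> level n y \<le> Suc (level n x)} \<rparr>"

text \<open>One of the two truncated differences vanishes, so their sum is the distance of the levels.\<close>

definition level_dist :: "nat \<Rightarrow> nat \<Rightarrow> nat \<Rightarrow> nat" where
  "level_dist n x y =
     (if x = y then 0
      else max 1 ((level n x - level n y) + (level n y - level n x)))"

lemma verts_doubled_path [simp]: "pverts (doubled_path n) = {0..n + 2}"
  by (simp add: doubled_path_def)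

lemma arcs_doubled_path:
  "(x, y) \<in> parcs (doubled_path n) \<longleftrightarrow>
     x \<le> n + 2 \<and> y \<le> n + 2 \<and> x \<noteq> y \<and>
     level n x \<le> Suc (level n y) \<and> level n y \<le> Suc (level n x)"
  by (auto simp: doubled_path_def)

lemma successive_adjacent: "i < n + 2 \<Longrightarrow> (i, Suc i) \<in> parcs (doubled_path n)"
  by (auto simp: arcs_doubled_path level_def)

lemma pair_graph_doubled_path: "pair_graph (doubled_path n)"
proof
  show "finite (parcs (doubled_path n))"
    by (rule finite_subset[of _ "{0..n + 2} \<times> {0..n + 2}"]) (auto simp: arcs_doubled_path)
  show "symmetric (with_proj (doubled_path n))"
    by (auto simp: symmetric_def sym_def arcs_doubled_path)
qed (auto simp: arcs_doubled_path)

lemma connected_doubled_path: "Digraph_Component.connected (with_proj (doubled_path n))"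
  by (rule connected_if_successive_adjacent[of _ 0 "n + 2"]) (auto intro: successive_adjacent)

lemma arcs_ends_induced:
  "arcs_ends (with_proj G \<restriction> S) = {(x, y) \<in> parcs G. x \<in> S \<and> y \<in> S}"
  by (auto simp: arcs_ends_conv)

lemma connected_induced_interval:
  assumes "a \<le> b" "b \<le> n + 2"
  shows "Digraph_Component.connected (with_proj (doubled_path n) \<restriction> {a..b})"
  using assms
  by (intro connected_if_successive_adjacent[of _ a b])
    (auto simp: arcs_ends_induced intro: successive_adjacent)

lemma level_dist_descent:
  assumes x: "x \<le> n + 2" and y: "y \<le> n + 2" and "x \<noteq> y"
  shows "\<exists>z. (x, z) \<in> parcs (doubled_path n) \<and> level_dist n x y = Suc (level_dist n z y)"
proof -
  consider (near) "level n x \<le> Suc (level n y)" "level n y \<le> Suc (level n x)"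
    | (up) "level n y > Suc (level n x)" | (down) "level n x > Suc (level n y)"
    by linarith
  then show ?thesis
  proof cases
    case near
    then show ?thesis
      using assms by (intro exI[of _ y]) (auto simp: arcs_doubled_path level_dist_def)
  next
    case up
    \<comment> \<open>The vertex \<open>x + 1\<close> would not do for \<open>x = 0\<close>, whose twin is \<open>1\<close>.\<close>
    have "level n y \<le> n" by (simp add: level_def)
    with up have "level n (level n x + 2) = level n x + 1" by (simp add: level_def)
    moreover from this have "x \<noteq> level n x + 2" by (metis n_not_Suc_n Suc_eq_plus1)
    ultimately show ?thesis
      using up \<open>level n y \<le> n\<close> assms by (intro exI[of _ "level n x + 2"])
        (auto simp: arcs_doubled_path level_dist_def)
  next
    case down
    have "level n x \<le> n" by (simp add: level_def)
    then have pred: "level n (level n x) = level n x - 1" by (simp add: level_def)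
    with down have "x \<noteq> level n x" "level n x \<noteq> y" by auto
    then show ?thesis
      using pred down \<open>level n x \<le> n\<close> assms by (intro exI[of _ "level n x"])
        (simp add: arcs_doubled_path level_dist_def, linarith)
  qed
qed

lemma gdist_doubled_path:
  assumes x: "x \<le> n + 2" and y: "y \<le> n + 2"
  shows "gdist (with_proj (doubled_path n)) x y = ereal (real (level_dist n x y))"
proof (rule gdist_eq_potential[where f = "\<lambda>w. level_dist n w y"])
  interpret pair_graph "doubled_path n" by (rule pair_graph_doubled_path)
  show "wf_digraph (with_proj (doubled_path n))" ..
  show "level_dist n (tail (with_proj (doubled_path n)) e) y
      \<le> Suc (level_dist n (head (with_proj (doubled_path n)) e) y)"
    if "e \<in> arcs (with_proj (doubled_path n))" for e
    using that by (cases e) (auto simp: arcs_doubled_path level_dist_def)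
  show "\<exists>e \<in> arcs (with_proj (doubled_path n)). tail (with_proj (doubled_path n)) e = w \<and>
      level_dist n w y = Suc (level_dist n (head (with_proj (doubled_path n)) e) y)"
    if "w \<in> verts (with_proj (doubled_path n))" "w \<noteq> y" for w
    using level_dist_descent[of w n y] that y by force
qed (use x in \<open>auto simp: level_dist_def\<close>)

section \<open>Resolving sets and the two dimensions\<close>

text \<open>Two vertices of the same level are twins: all other vertices see them at the same distance.\<close>

lemma resolving_set_meets_twins:
  assumes S: "resolving_set (with_proj (doubled_path n)) S"
    and "x \<le> n + 2" "y \<le> n + 2" "x \<noteq> y" and "level n x = level n y"
  shows "x \<in> S \<or> y \<in> S"
proof -
  have "x \<in> verts (with_proj (doubled_path n))" "y \<in> verts (with_proj (doubled_path n))"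
    using assms by simp_all
  then obtain z where z: "z \<in> S"
    "gdist (with_proj (doubled_path n)) x z \<noteq> gdist (with_proj (doubled_path n)) y z"
    using S \<open>x \<noteq> y\<close> unfolding resolving_set_def by blast
  have "S \<subseteq> {0..n + 2}"
    using S by (simp add: resolving_set_def)
  then have "z \<le> n + 2"
    using z(1) by auto
  then have "level_dist n x z \<noteq> level_dist n y z"
    using z(2) assms(2,3) by (simp add: gdist_doubled_path)
  then have "z = x \<or> z = y"
    using \<open>level n x = level n y\<close> unfolding level_dist_def by metis
  then show ?thesis using z(1) by auto
qed

lemma resolving_set_meets_ends:
  assumes "resolving_set (with_proj (doubled_path n)) S"
  obtains a b where "a \<in> S" "level n a = 0" "b \<in> S" "level n b = n"
proof -
  have "0 \<in> S \<or> 1 \<in> S"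
    by (rule resolving_set_meets_twins[OF assms]) (auto simp: level_def)
  moreover have "n + 1 \<in> S \<or> n + 2 \<in> S"
    by (rule resolving_set_meets_twins[OF assms]) (auto simp: level_def)
  ultimately
  show thesis using that by (auto simp: level_def)
qed

lemma level_dist_ends:
  assumes "w \<le> n + 2" "n \<ge> 2"
  shows "level_dist n w 1 = (if w = 0 then 1 else if w = n + 2 then n else w - 1)"
    and "level_dist n w (n + 1) = (if w = n + 2 then 1 else if w = 0 then n else n + 1 - w)"
proof -
  consider "w = 0" | "w = n + 2" | "1 \<le> w" "w \<le> n + 1"
    using assms by linarith
  then have "level_dist n w 1 = (if w = 0 then 1 else if w = n + 2 then n else w - 1) \<and>
    level_dist n w (n + 1) = (if w = n + 2 then 1 else if w = 0 then n else n + 1 - w)"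
  proof cases
    case 3
    then have "level n w = w - 1" by (simp add: level_def)
    moreover have "level n 1 = 0" "level n (n + 1) = n" by (simp_all add: level_def)
    ultimately show ?thesis using 3 unfolding level_dist_def by simp
  qed (use assms in \<open>simp_all add: level_dist_def level_def\<close>)
  then show "level_dist n w 1 = (if w = 0 then 1 else if w = n + 2 then n else w - 1)"
    and "level_dist n w (n + 1) = (if w = n + 2 then 1 else if w = 0 then n else n + 1 - w)"
    by blast+
qed

text \<open>
  The distances to \<open>1\<close> and \<open>n + 1\<close> add up to \<open>n\<close>, except for the other two
  twins, where they add up to \<open>n + 1\<close>. Vertices with sum \<open>n\<close> differ in their
  distance to \<open>1\<close>; for the two with sum \<open>n + 1\<close> this distance is \<open>1\<close>
  and \<open>n\<close>, which differ because \<open>n \<ge> 2\<close>.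
\<close>

lemma resolving_set_if_ends:
  assumes S: "S \<subseteq> {0..n + 2}" "1 \<in> S" "n + 1 \<in> S" and n: "n \<ge> 2"
  shows "resolving_set (with_proj (doubled_path n)) S"
  unfolding resolving_set_def
proof (intro conjI ballI impI)
  fix x y
  assume "x \<in> verts (with_proj (doubled_path n))" "y \<in> verts (with_proj (doubled_path n))"
    and "x \<noteq> y"
  then have xy: "x \<le> n + 2" "y \<le> n + 2" by simp_all
  have "level_dist n x 1 \<noteq> level_dist n y 1 \<or>
      level_dist n x (n + 1) \<noteq> level_dist n y (n + 1)"
    using xy \<open>x \<noteq> y\<close> n unfolding level_dist_ends[OF xy(1) n] level_dist_ends[OF xy(2) n]
    by (simp split: if_splits; linarith)
  then obtain z where "z \<in> {1, n + 1}" "level_dist n x z \<noteq> level_dist n y z" by blast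
  moreover from this have "z \<in> S" "z \<le> n + 2" using S by auto
  ultimately show "\<exists>z\<in>S. gdist (with_proj (doubled_path n)) x z \<noteq> gdist (with_proj (doubled_path n)) y z"
    using xy by (intro bexI[of _ z]) (simp_all add: gdist_doubled_path)
qed (use S in auto)

lemma metric_dim_doubled_path:
  assumes "n \<ge> 2"
  shows "metric_dim (with_proj (doubled_path n)) = 2"
  unfolding metric_dim_def
proof (rule Least_equality)
  have "resolving_set (with_proj (doubled_path n)) {1, n + 1}"
    using assms by (intro resolving_set_if_ends) auto
  then show "\<exists>S. resolving_set (with_proj (doubled_path n)) S \<and> card S = 2"
    using assms by (intro exI[of _ "{1, n + 1}"]) auto
next
  fix m
  assume "\<exists>S. resolving_set (with_proj (doubled_path n)) S \<and> card S = m"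
  then obtain S where S: "resolving_set (with_proj (doubled_path n)) S" "card S = m"
    by blast
  obtain a b where ab: "a \<in> S" "level n a = 0" "b \<in> S" "level n b = n"
    using S(1) by (rule resolving_set_meets_ends)
  then have "a \<noteq> b" using assms by auto
  then have "card {a, b} = 2" by simp
  moreover have "finite S"
    using S(1) by (auto simp: resolving_set_def intro: finite_subset)
  ultimately show "2 \<le> m"
    using ab S(2) card_mono[of S "{a, b}"] by auto
qed

lemma connected_covers_levels:
  assumes "connected_resolving_set (with_proj (doubled_path n)) S"
  shows "{0..n} \<subseteq> level n ` S"
proof -
  have conn: "Digraph_Component.connected (with_proj (doubled_path n) \<restriction> S)"
    and "resolving_set (with_proj (doubled_path n)) S"
    using assms by (auto simp: connected_resolving_set_def)
  then obtain a b where "a \<in> S" "level n a = 0" "b \<in> S" "level n b = n"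
    using resolving_set_meets_ends by blast
  then show ?thesis
    using connected_label_ivt[OF conn, of "level n" a b]
    by (auto simp: arcs_ends_induced arcs_doubled_path)
qed

lemma connected_metric_dim_doubled_path:
  assumes "n \<ge> 2"
  shows "connected_metric_dim (with_proj (doubled_path n)) = n + 1"
  unfolding connected_metric_dim_def
proof (rule Least_equality)
  have "connected_resolving_set (with_proj (doubled_path n)) {1..n + 1}"
    unfolding connected_resolving_set_def
    using assms by (intro conjI resolving_set_if_ends connected_induced_interval) auto
  then show "\<exists>S. connected_resolving_set (with_proj (doubled_path n)) S \<and> card S = n + 1"
    by (intro exI[of _ "{1..n + 1}"]) auto
next
  fix m
  assume "\<exists>S. connected_resolving_set (with_proj (doubled_path n)) S \<and> card S = m"
  then obtain S where S: "connected_resolving_set (with_proj (doubled_path n)) S" "card S = m"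
    by blast
  have fin: "finite S"
    using S(1) by (auto simp: connected_resolving_set_def resolving_set_def intro: finite_subset)
  have "n + 1 = card {0..n}" by simp
  also have "\<dots> \<le> card S"
    using surj_card_le[OF fin connected_covers_levels[OF S(1)]] .
  finally show "n + 1 \<le> m" using S(2) by simp
qed

theorem mainTheorem13:
  fixes k :: nat
  assumes "k \<ge> 1"
  shows "\<exists>G :: nat pair_pre_digraph.
           pair_graph G \<and> card (pverts G) \<ge> 2 \<and> Digraph_Component.connected (with_proj G) \<and>
           int (connected_metric_dim (with_proj G)) - int (metric_dim (with_proj G)) = int k"
proof (intro exI[of _ "doubled_path (k + 1)"] conjI)
  show "int (connected_metric_dim (with_proj (doubled_path (k + 1)))) -
      int (metric_dim (with_proj (doubled_path (k + 1)))) = int k"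
    using assms by (simp add: metric_dim_doubled_path connected_metric_dim_doubled_path)
qed (auto simp: pair_graph_doubled_path connected_doubled_path)

end
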